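(* Let $\mathcal{A}$ be a unital $C^*$-algebra and let $\mathcal{F}\subseteq\mathcal{A}\cong B(\mathcal{A})$ be an ideal of finite type elements. Let $F\in\mathcal{M}\mathcal{K}\Phi(\mathcal{A})\cap\mathcal{M}\mathcal{K}{\Phi_{+}^{-}}'(\mathcal{A})\cap\mathcal{M}\mathcal{K}{\Phi_{-}^{+}}'(\mathcal{A})$. Then there exists an $\mathcal{M}\mathcal{K}\Phi$-decomposition $$\mathcal{A}=M_1\tilde\oplus N_1\stackrel{F}{\longrightarrow}M_2\tilde\oplus N_2=\mathcal{A}$$ for $F$ with the property that $N_1\preceq N_2$ and $N_2\preceq N_1$.
   Context: $\mathcal{A}$ is regarded as a right Hilbert module over itself and $B(\mathcal{A})$ is the $C^*$-algebra of all bounded $\mathcal{A}$-linear operators on $\mathcal{A}$ (all are adjointable). The map $a\mapsto L_a$ (left multiplication by $a$) is an isometric $*$-isomorphism $\mathcal{A}\to B(\mathcal{A})$, and $\mathcal{A}$ is identified with $B(\mathcal{A})$ through it; accordingly $\mathcal{F}$ is identified with its image in $B(\mathcal{A})$. Ideal of finite type elements: a subalgebra $\mathcal{F}\subseteq\mathcal{A}$ such that (i) $\mathcal{F}$ is a selfadjoint (two-sided) ideal in $\mathcal{A}$; (ii) there is an approximate unit $\{P_\alpha\}$ for $\mathcal{F}$, contained in $\mathcal{F}$, consisting of (orthogonal) projections; (iii) if $p,q\in\mathcal{F}$ are projections, then there exists $v\in\mathcal{A}$ such that $vv^*=q$ and $v^*v\perp p$, i.e. $v^*v+p$ is a projection as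 well. For closed submodules $M_1,M_2$ of a Hilbert module $M$, $M=M_1\tilde\oplus M_2$ means $M_1\cap M_2=\{0\}$ and $M_1+M_2=M$ (not necessarily orthogonal). A closed submodule is complementable if it is a summand in such a decomposition. Every closed complementable submodule $M$ of $\mathcal{A}$ is orthogonally complementable; $P_M$ denotes the orthogonal projection onto $M$. Isomorphism means a bounded $\mathcal{A}$-linear bijection with bounded inverse, and $N\preceq N'$ means that $N$ is isomorphic to a closed submodule of $N'$. For $F\in B(\mathcal{A})$ consider decompositions $\mathcal{A}=M_1\tilde\oplus N_1\stackrel{F}{\longrightarrow}M_2\tilde\oplus N_2=\mathcal{A}$ (closed submodules) with respect to which $F$ has the matrix $\begin{pmatrix}F_1&0\\0&F_4\end{pmatrix}$ with $F_1:M_1\to M_2$ an isomorphism. Such a decomposition is called an $\mathcal{M}\mathcal{K}\Phi_+$-decomposition if $P_{N_1}\in\mathcal{F}$, an $\mathcal{M}\mathcal{K}\Phi_-$-decomposition if $P_{N_2}\in\mathcal{F}$, and an $\mathcal{M}\mathcal{K}\Phi$-decomposition if $P_{N_1},P_{N_2}\in\mathcal{F}$. $\mathcal{M}\mathcal{K}\Phi(\mathcal{A})$ is the set of $F\in B(\mathcal{A})$ admitting an $\mathcal{M}\mathcal{K}\Phi$-decomposition. $\mathcal{M}\mathcal{K}{\Phi_{+}^{-}}'(\mathcal{A})$ is the set of $F$ admitting an $\mathcal{M}\mathcal{K}\Phi_+$-decomposition with $N_1\preceq N_2$. $\mathcal{M}\mathcal{K}{\Phi_{-}^{+}}'(\mathcal{A})$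 is the set of $F$ admitting an $\mathcal{M}\mathcal{K}\Phi_-$-decomposition with $N_2\preceq N_1$. *)

theory Defs
  imports "HOL-Analysis.Analysis"
begin

section \<open>Unital \<open>C\<^sup>*\<close>-algebras\<close>

text \<open>
  The unit is added through class \<^class>\<open>monoid_mult\<close> rather than \<open>real_normed_algebra_1\<close>, so that the
  zero algebra is not excluded. In every other case \<open>norm 1 = 1\<close> follows from the \<open>C\<^sup>*\<close>-identity.
\<close>

class unital_cstar_algebra = real_normed_algebra + banach + monoid_mult +
  fixes scaleC :: "complex \<Rightarrow> 'a \<Rightarrow> 'a"  (infixr "*\<^sub>C" 75)
    and star :: "'a \<Rightarrow> 'a"
  assumes scaleC_add_right: "c *\<^sub>C (x + y) = c *\<^sub>C x + c *\<^sub>C y"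
    and scaleC_add_left: "(c + d) *\<^sub>C x = c *\<^sub>C x + d *\<^sub>C x"
    and scaleC_scaleC: "c *\<^sub>C d *\<^sub>C x = (c * d) *\<^sub>C x"
    and scaleC_one: "1 *\<^sub>C x = x"
    and scaleR_scaleC: "r *\<^sub>R x = complex_of_real r *\<^sub>C x"
    and mult_scaleC_left: "(c *\<^sub>C x) * y = c *\<^sub>C (x * y)"
    and mult_scaleC_right: "x * (c *\<^sub>C y) = c *\<^sub>C (x * y)"
    and norm_scaleC: "norm (c *\<^sub>C x) = cmod c * norm x"
    and star_add: "star (x + y) = star x + star y"
    and star_scaleC: "star (c *\<^sub>C x) = cnj c *\<^sub>C star x"
    and star_mult: "star (x * y) = star y * star x"
    and star_star: "star (star x) = x"
    and cstar_identity: "norm (star x * x) = (norm x)\<^sup>2"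

definition is_projection :: "'a::unital_cstar_algebra \<Rightarrow> bool" where
  "is_projection p \<longleftrightarrow> p * p = p \<and> star p = p"

section \<open>Ideals of finite type elements\<close>

text \<open>
  A net of projections in \<open>\<F>\<close> is represented by its filter of tails, a proper filter \<open>U\<close> on the
  algebra; the net converges in norm along its index set iff it converges along \<open>U\<close>, and every
  proper filter arises in this way. The net is not required to be increasing, and \<open>\<F>\<close> is not
  required to be norm closed.
\<close>

definition has_approximate_unit_of_projections :: "'a::unital_cstar_algebra set \<Rightarrow> bool" where
  "has_approximate_unit_of_projections \<F> \<longleftrightarrow>
    (\<exists>U :: 'a filter. U \<noteq> bot \<and>
      (\<forall>\<^sub>F p in U. p \<in> \<F> \<and> is_projection p) \<and>
      (\<forall>a\<in>\<F>. ((\<lambda>p. p * a) \<longlongrightarrow> a) U \<and> ((\<lambda>p. a * p) \<longlongrightarrow> a) U))"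

definition subalgebra :: "'a::unital_cstar_algebra set \<Rightarrow> bool" where
  "subalgebra \<F> \<longleftrightarrow> 0 \<in> \<F> \<and> (\<forall>a\<in>\<F>. \<forall>b\<in>\<F>. a + b \<in> \<F> \<and> a * b \<in> \<F>) \<and> (\<forall>c. \<forall>a\<in>\<F>. c *\<^sub>C a \<in> \<F>)"

definition selfadjoint_ideal :: "'a::unital_cstar_algebra set \<Rightarrow> bool" where
  "selfadjoint_ideal \<F> \<longleftrightarrow> subalgebra \<F> \<and> (\<forall>a. \<forall>b\<in>\<F>. a * b \<in> \<F> \<and> b * a \<in> \<F>) \<and> (\<forall>b\<in>\<F>. star b \<in> \<F>)"

definition finite_type_ideal :: "'a::unital_cstar_algebra set \<Rightarrow> bool" where
  "finite_type_ideal \<F> \<longleftrightarrow>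
    selfadjoint_ideal \<F> \<and>
    has_approximate_unit_of_projections \<F> \<and>
    (\<forall>p\<in>\<F>. \<forall>q\<in>\<F>. is_projection p \<longrightarrow> is_projection q \<longrightarrow>
      (\<exists>v. v * star v = q \<and> is_projection (star v * v + p)))"

section \<open>The algebra as a right Hilbert module over itself\<close>

text \<open>
  By the \<open>C\<^sup>*\<close>-identity, the Hilbert module norm \<open>sqrt (norm (ainner x x))\<close> is the norm of the algebra.
\<close>

definition ainner :: "'a::unital_cstar_algebra \<Rightarrow> 'a \<Rightarrow> 'a" where
  "ainner x y = star x * y"

text \<open>
  Since the algebra is unital, \<open>c *\<^sub>C x = x * (c *\<^sub>C 1)\<close>. Hence closure under right multiplication
  includes closure under complex scalars, and \<open>A\<close>-linear maps are complex linear.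
\<close>

definition closed_submodule :: "'a::unital_cstar_algebra set \<Rightarrow> bool" where
  "closed_submodule M \<longleftrightarrow>
    closed M \<and> 0 \<in> M \<and> (\<forall>x\<in>M. \<forall>y\<in>M. x + y \<in> M) \<and> (\<forall>x\<in>M. \<forall>a. x * a \<in> M)"

definition bounded_module_map :: "('a::unital_cstar_algebra \<Rightarrow> 'a) \<Rightarrow> 'a set \<Rightarrow> 'a set \<Rightarrow> bool" where
  "bounded_module_map f M N \<longleftrightarrow>
    f ` M \<subseteq> N \<and>
    (\<forall>x\<in>M. \<forall>y\<in>M. f (x + y) = f x + f y) \<and>
    (\<forall>x\<in>M. \<forall>a. f (x * a) = f x * a) \<and>
    (\<exists>K. \<forall>x\<in>M. norm (f x) \<le> K * norm x)"

definition module_operators :: "('a::unital_cstar_algebra \<Rightarrow> 'a) set" where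
  "module_operators = {F. bounded_module_map F UNIV UNIV}"

definition module_iso :: "('a::unital_cstar_algebra \<Rightarrow> 'a) \<Rightarrow> 'a set \<Rightarrow> 'a set \<Rightarrow> bool" where
  "module_iso f M N \<longleftrightarrow>
    bounded_module_map f M N \<and> bij_betw f M N \<and> bounded_module_map (inv_into M f) N M"

definition embeds :: "'a::unital_cstar_algebra set \<Rightarrow> 'a set \<Rightarrow> bool"  (infix "\<preceq>" 50) where
  "N \<preceq> N' \<longleftrightarrow> (\<exists>K f. closed_submodule K \<and> K \<subseteq> N' \<and> module_iso f N K)"

definition direct_decomposition :: "'a::unital_cstar_algebra set \<Rightarrow> 'a set \<Rightarrow> bool" where
  "direct_decomposition M N \<longleftrightarrow>
    closed_submodule M \<and> closed_submodule N \<and> M \<inter> N = {0} \<and> {x + y | x y. x \<in> M \<and> y \<in> N} = UNIV"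

definition is_orthogonal_projection_onto :: "('a::unital_cstar_algebra \<Rightarrow> 'a) \<Rightarrow> 'a set \<Rightarrow> bool" where
  "is_orthogonal_projection_onto P M \<longleftrightarrow> (\<forall>x. P x \<in> M \<and> (\<forall>y\<in>M. ainner y (x - P x) = 0))"

text \<open>
  This says \<open>P\<^sub>N \<in> \<F>\<close>, where \<open>\<F>\<close> is identified with the set of its left multiplication operators.
  There is at most one orthogonal projection onto a submodule, and there is one onto every closed
  complementable submodule.
\<close>

definition proj_in :: "'a::unital_cstar_algebra set \<Rightarrow> 'a set \<Rightarrow> bool" where
  "proj_in \<F> N \<longleftrightarrow> (\<exists>P \<in> (*) ` \<F>. is_orthogonal_projection_onto P N)"

section \<open>Fredholm type decompositions\<close>

text \<open>
  The operator matrix of \<open>F\<close> is diagonal iff \<open>F\<close> maps \<open>M1\<close> into \<open>M2\<close> and \<open>N1\<close> into \<open>N2\<close>.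
\<close>

definition iso_decomposition ::
    "('a::unital_cstar_algebra \<Rightarrow> 'a) \<Rightarrow> 'a set \<Rightarrow> 'a set \<Rightarrow> 'a set \<Rightarrow> 'a set \<Rightarrow> bool" where
  "iso_decomposition F M1 N1 M2 N2 \<longleftrightarrow>
    direct_decomposition M1 N1 \<and> direct_decomposition M2 N2 \<and>
    F ` M1 \<subseteq> M2 \<and> F ` N1 \<subseteq> N2 \<and> module_iso F M1 M2"

definition MKPhi_plus_decomposition ::
    "'a::unital_cstar_algebra set \<Rightarrow> ('a \<Rightarrow> 'a) \<Rightarrow> 'a set \<Rightarrow> 'a set \<Rightarrow> 'a set \<Rightarrow> 'a set \<Rightarrow> bool" where
  "MKPhi_plus_decomposition \<F> F M1 N1 M2 N2 \<longleftrightarrow> iso_decomposition F M1 N1 M2 N2 \<and> proj_in \<F> N1"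

definition MKPhi_minus_decomposition ::
    "'a::unital_cstar_algebra set \<Rightarrow> ('a \<Rightarrow> 'a) \<Rightarrow> 'a set \<Rightarrow> 'a set \<Rightarrow> 'a set \<Rightarrow> 'a set \<Rightarrow> bool" where
  "MKPhi_minus_decomposition \<F> F M1 N1 M2 N2 \<longleftrightarrow> iso_decomposition F M1 N1 M2 N2 \<and> proj_in \<F> N2"

definition MKPhi_decomposition ::
    "'a::unital_cstar_algebra set \<Rightarrow> ('a \<Rightarrow> 'a) \<Rightarrow> 'a set \<Rightarrow> 'a set \<Rightarrow> 'a set \<Rightarrow> 'a set \<Rightarrow> bool" where
  "MKPhi_decomposition \<F> F M1 N1 M2 N2 \<longleftrightarrow>
    iso_decomposition F M1 N1 M2 N2 \<and> proj_in \<F> N1 \<and> proj_in \<F> N2"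

definition MKPhi :: "'a::unital_cstar_algebra set \<Rightarrow> ('a \<Rightarrow> 'a) set" where
  "MKPhi \<F> = {F \<in> module_operators. \<exists>M1 N1 M2 N2. MKPhi_decomposition \<F> F M1 N1 M2 N2}"

text \<open>
  \<open>MKPhi_plus_minus'\<close> is \<open>MK\<Phi>\<^sub>+\<^sup>-'\<close> (subscript \<open>+\<close>, superscript \<open>-\<close>), and \<open>MKPhi_minus_plus'\<close> is \<open>MK\<Phi>\<^sub>-\<^sup>+'\<close>.
\<close>

definition MKPhi_plus_minus' :: "'a::unital_cstar_algebra set \<Rightarrow> ('a \<Rightarrow> 'a) set" where
  "MKPhi_plus_minus' \<F> =
    {F \<in> module_operators. \<exists>M1 N1 M2 N2. MKPhi_plus_decomposition \<F> F M1 N1 M2 N2 \<and> N1 \<preceq> N2}"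

definition MKPhi_minus_plus' :: "'a::unital_cstar_algebra set \<Rightarrow> ('a \<Rightarrow> 'a) set" where
  "MKPhi_minus_plus' \<F> =
    {F \<in> module_operators. \<exists>M1 N1 M2 N2. MKPhi_minus_decomposition \<F> F M1 N1 M2 N2 \<and> N2 \<preceq> N1}"

end

theory Submission imports Defs begin

text \<open>
  Since the algebra is unital, \<open>F\<close> is left multiplication by \<open>a = F 1\<close>, and a decomposition of the
  algebra into two closed submodules is given by an idempotent. Under this translation the
  decompositions that make \<open>F\<close> diagonal with invertible first entry are exactly the outer inverses of
  \<open>a\<close>, the elements \<open>b\<close> with \<open>b * a * b = b\<close>: the summands \<open>N1\<close> and \<open>N2\<close> are the ranges of the
  idempotents \<open>1 - b * a\<close> and \<open>1 - a * b\<close>. The projection onto the range of an idempotent lies in an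
  ideal iff the idempotent does, so the finiteness conditions say that \<open>b\<close> is a left or right
  inverse of \<open>a\<close> modulo \<open>\<F>\<close>.

  Let \<open>b1\<close> and \<open>b2\<close> be outer inverses with \<open>N1 \<preceq> N2\<close> for \<open>b1\<close> and \<open>N2 \<preceq> N1\<close> for \<open>b2\<close>. One is a left
  inverse modulo \<open>\<F>\<close> and the other a right inverse; as \<open>F\<close> is Fredholm, \<open>a\<close> is invertible modulo \<open>\<F>\<close>
  and both are two-sided inverses modulo \<open>\<F>\<close> (\<open>inverse_modulo_ideal\<close>).

  It remains to compare the two. Choose a projection \<open>p\<close> in the approximate unit that almost fixes
  both \<open>1 - b1 * a\<close> and \<open>1 - b2 * a\<close>. Then the range of \<open>1 - p\<close> is almost contained in both \<open>M1\<close>'s;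
  pushing it into them gives smaller decompositions, with outer inverses \<open>c1\<close> and \<open>c2\<close>
  (\<open>shrink_outer_inverse\<close>). Passing from \<open>b\<close> to \<open>c\<close> adds to \<open>N1\<close> and to \<open>N2\<close> two summands that \<open>F\<close>
  identifies, so that it preserves the relations \<open>N1 \<preceq> N2\<close> and \<open>N2 \<preceq> N1\<close>
  (\<open>outer_inverse_le_embeds\<close>). On the other hand the first summands of the new decompositions are
  both small perturbations of the range of \<open>1 - p\<close>, and their images under \<open>F\<close> are small
  perturbations of each other; hence invertible elements carry one to the other, and the complements
  are isomorphic (\<open>shrunk_kernels_embed\<close>, \<open>shrunk_cokernels_embed\<close>). Altogether, writing \<open>N1\<close>, \<open>N2\<close>
  for the summands that belong to \<open>c1\<close> and \<open>N1'\<close>, \<open>N2'\<close> for those of \<open>c2\<close>, there is the cycle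
  \<open>N1 \<preceq> N2 \<preceq> N2' \<preceq> N1' \<preceq> N1\<close>, and the decomposition of \<open>c1\<close> is as required.
\<close>

section \<open>Invertible elements\<close>

lemma star_one [simp]: "star (1::'a::unital_cstar_algebra) = 1"
  by (metis mult_1_right star_mult star_star)

lemma norm_one_le: "norm (1::'a::unital_cstar_algebra) \<le> 1"
proof -
  have "norm (1::'a) = (norm (1::'a))\<^sup>2"
    using cstar_identity[of "1::'a"] by simp
  then have "norm (1::'a) = 0 \<or> norm (1::'a) = 1"
    by (simp add: power2_eq_square)
  then show ?thesis by auto
qed

lemma star_zero [simp]: "star (0::'a::unital_cstar_algebra) = 0"
  using star_add[of 0 "0::'a"] by simp

lemma star_minus: "star (- x) = - star (x::'a::unital_cstar_algebra)"
  using star_add[of x "- x"] by (simp add: eq_neg_iff_add_eq_0 add.commute)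

lemma star_diff: "star (x - y) = star x - star (y::'a::unital_cstar_algebra)"
  using star_add[of x "- y"] by (simp add: star_minus)

lemma star_scaleR: "star (r *\<^sub>R x) = r *\<^sub>R star (x::'a::unital_cstar_algebra)"
  by (simp add: scaleR_scaleC star_scaleC)

text \<open>
  The Banach fixed point theorem replaces the geometric series: a right inverse of \<open>x\<close> is a fixed
  point of \<open>y \<mapsto> 1 + (1 - x) * y\<close>, a left inverse one of the mirrored map.
\<close>
lemma neumann_inverse:
  fixes x :: "'a::unital_cstar_algebra"
  assumes "norm (1 - x) < 1"
  obtains y where "x * y = 1" "y * x = 1" "norm y * (1 - norm (1 - x)) \<le> 1"
proof -
  have "\<exists>!y. 1 + (1 - x) * y = y"
  proof (rule banach_fix_type)
    show "\<forall>y z. dist (1 + (1 - x) * y) (1 + (1 - x) * z) \<le> norm (1 - x) * dist y z"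
      using norm_mult_ineq[of "1 - x"] by (simp add: dist_norm flip: right_diff_distrib)
  qed (use assms in auto)
  then obtain y where y: "1 + (1 - x) * y = y" by auto
  have "\<exists>!y. 1 + y * (1 - x) = y"
  proof (rule banach_fix_type)
    show "\<forall>y z. dist (1 + y * (1 - x)) (1 + z * (1 - x)) \<le> norm (1 - x) * dist y z"
      using norm_mult_ineq[of _ "1 - x"]
      by (simp add: dist_norm mult.commute[of "norm (1 - x)"] flip: left_diff_distrib)
  qed (use assms in auto)
  then obtain z where z: "1 + z * (1 - x) = z" by auto
  have xy: "x * y = 1" and zx: "z * x = 1"
    using y z by (simp_all add: algebra_simps)
  then have "z = y"
    by (metis mult.assoc mult_1_left mult_1_right)
  have "norm y \<le> norm (1::'a) + norm ((1 - x) * y)"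
    using norm_triangle_ineq[of 1 "(1 - x) * y"] y by simp
  also have "\<dots> \<le> 1 + norm (1 - x) * norm y"
    using norm_one_le norm_mult_ineq by (intro add_mono) auto
  finally have "norm y * (1 - norm (1 - x)) \<le> 1"
    by (simp add: algebra_simps)
  with xy zx \<open>z = y\<close> show ?thesis using that by blast
qed

text \<open>
  The spectrum of a skew-adjoint element is imaginary. This is Arens' trick: for large real \<open>s\<close>
  the \<open>C\<^sup>*\<close>-identity gives \<open>norm (s - x) \<le> sqrt (s\<^sup>2 + (norm x)\<^sup>2) < 1 + s\<close>, and so
  \<open>1 + x = (1 + s) - (s - x)\<close> is invertible by the Neumann lemma. No functional calculus is involved.
\<close>
lemma skew_adjoint_one_plus_invertible:
  fixes x :: "'a::unital_cstar_algebra"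
  assumes "star x = - x"
  obtains y where "(1 + x) * y = 1" "y * (1 + x) = 1"
proof -
  \<comment> \<open>Any \<open>s\<close> with \<open>2 * s + 1 > (norm x)\<^sup>2\<close> works.\<close>
  define s where "s = (norm x)\<^sup>2"
  define d where "d = s *\<^sub>R 1 - x"
  have s0: "s \<ge> 0" by (simp add: s_def)
  have "star d * d = (s * s) *\<^sub>R 1 - x * x"
    by (simp add: d_def star_diff star_scaleR assms algebra_simps)
  then have "(norm d)\<^sup>2 = norm ((s * s) *\<^sub>R 1 - x * x)"
    by (metis cstar_identity)
  also have "\<dots> \<le> norm ((s * s) *\<^sub>R (1::'a)) + norm (x * x)"
    by (rule norm_triangle_ineq4)
  also have "\<dots> \<le> s * s + norm x * norm x"
    using mult_left_mono[OF norm_one_le[where 'a='a], of "s * s"] norm_mult_ineq[of x x]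
    by (intro add_mono) auto
  also have "\<dots> < (1 + s)\<^sup>2"
    using s0 by (simp add: s_def power2_eq_square algebra_simps add_pos_nonneg)
  finally have less: "norm d < 1 + s"
    using s0 by (simp add: power2_less_imp_less)
  define w where "w = (1 / (1 + s)) *\<^sub>R (1 + x)"
  have "(1 + s) *\<^sub>R (1 - w) = d"
    using s0 by (simp add: w_def d_def algebra_simps)
  then have "(1 + s) * norm (1 - w) = norm d"
    using s0 norm_scaleR[of "1 + s" "1 - w"] by simp
  then have "norm (1 - w) < 1"
    using less s0 by (smt (verit, ccfv_SIG) mult_le_cancel_left1)
  then obtain v where v: "w * v = 1" "v * w = 1"
    by (rule neumann_inverse)
  show ?thesis
    by (rule that[of "(1 / (1 + s)) *\<^sub>R v"]) (use v in \<open>simp_all add: w_def\<close>)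
qed

section \<open>Submodules defined by idempotents\<close>

text \<open>For an idempotent \<open>e\<close> this is its range; written as a fixed set, it is visibly closed.\<close>
definition fixed_module :: "'a::unital_cstar_algebra \<Rightarrow> 'a set" where
  "fixed_module e = {x. e * x = x}"

lemma mem_fixed_module [simp]: "x \<in> fixed_module e \<longleftrightarrow> e * x = x"
  by (simp add: fixed_module_def)

lemma closed_submodule_fixed_module: "closed_submodule (fixed_module e)"
proof -
  have "closed (fixed_module e)"
    unfolding fixed_module_def by (intro closed_Collect_eq continuous_intros)
  then show ?thesis
    by (simp add: closed_submodule_def distrib_left flip: mult.assoc)
qed

lemma direct_decomposition_fixed_module:
  assumes "e * e = e"
  shows "direct_decomposition (fixed_module e) (fixed_module (1 - e))"
proof -
  have "x \<in> {x + y |x y. x \<in> fixed_module e \<and> y \<in> fixed_module (1 - e)}" for x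
  proof -
    have "x = e * x + (1 - e) * x" by (simp add: algebra_simps)
    moreover have "e * x \<in> fixed_module e" "(1 - e) * x \<in> fixed_module (1 - e)"
      using assms by (simp_all add: algebra_simps flip: mult.assoc)
    ultimately show ?thesis by blast
  qed
  then show ?thesis
    by (auto simp: direct_decomposition_def closed_submodule_fixed_module algebra_simps)
qed

text \<open>
  The idempotent is the component of \<open>1\<close> in \<open>M\<close>, as the components of \<open>x = 1 * x\<close> are those of \<open>1\<close>
  multiplied by \<open>x\<close>.
\<close>
lemma direct_decomposition_idempotent:
  assumes "direct_decomposition M N"
  obtains e where "e * e = e" "M = fixed_module e" "N = fixed_module (1 - e)"
proof -
  have M: "closed_submodule M" and N: "closed_submodule N" and MN: "M \<inter> N = {0}"
    and "1 \<in> {x + y | x y. x \<in> M \<and> y \<in> N}"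
    using assms by (auto simp: direct_decomposition_def)
  then obtain e n where e: "e \<in> M" and n: "n \<in> N" and en: "1 = e + n" by blast
  have eM: "e * x \<in> M" and nN: "n * x \<in> N" for x
    using e n M N by (auto simp: closed_submodule_def)
  have split: "e * x + n * x = x" for x
    using en by (metis distrib_right mult_1_left)
  have uM: "x - y \<in> M" if "x \<in> M" "y \<in> M" for x y
  proof -
    have "x + y * (- 1) \<in> M" using M that by (simp add: closed_submodule_def del: mult_minus_right)
    then show ?thesis by simp
  qed
  have uN: "x - y \<in> N" if "x \<in> N" "y \<in> N" for x y
  proof -
    have "x + y * (- 1) \<in> N" using N that by (simp add: closed_submodule_def del: mult_minus_right)
    then show ?thesis by simp
  qed
  have M1: "e * x = x" if "x \<in> M" for x
  proof -
    have "n * x \<in> M" using uM[OF that eM[of x]] split[of x] by (metis add_diff_cancel_left')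
    then have "n * x = 0" using nN MN by blast
    then show ?thesis using split[of x] by simp
  qed
  have N1: "n * x = x" if "x \<in> N" for x
  proof -
    have "e * x \<in> N" using uN[OF that nN[of x]] split[of x] by (metis add_diff_cancel_right')
    then have "e * x = 0" using eM MN by blast
    then show ?thesis using split[of x] by simp
  qed
  have "n = 1 - e" using en by (metis add_diff_cancel_left')
  show ?thesis
  proof (rule that)
    show "e * e = e" using M1 e .
    show "M = fixed_module e" using M1 eM by (auto, metis)
    show "N = fixed_module (1 - e)" using N1 nN unfolding \<open>n = 1 - e\<close>[symmetric] by (auto, metis)
  qed
qed

lemma proj_in_fixed_moduleD:
  assumes "selfadjoint_ideal \<F>" "e * e = e" "proj_in \<F> (fixed_module e)"
  shows "e \<in> \<F>"
proof -
  obtain p where p: "p \<in> \<F>" "is_orthogonal_projection_onto ((*) p) (fixed_module e)"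
    using assms(3) by (auto simp: proj_in_def)
  have ep: "e * (p * x) = p * x" and orth: "e * y = y \<Longrightarrow> star y * (x - p * x) = 0" for x y
    using p(2) by (auto simp: is_orthogonal_projection_onto_def ainner_def)
  have "e * (e - p * e) = e - p * e"
    using ep[of e] assms(2) by (simp add: algebra_simps)
  from orth[OF this, of e] have "norm (e - p * e) = 0"
    using cstar_identity[of "e - p * e"] by simp
  then have "e = p * e" by simp
  then show ?thesis using p(1) assms(1) by (metis selfadjoint_ideal_def)
qed

text \<open>
  The projection onto the range of the idempotent \<open>e\<close> is Kaplansky's \<open>e * star e * inverse z\<close> with
  \<open>z = 1 + star x * x\<close> and \<open>x = star e - e\<close>. Invertibility of \<open>z\<close> would usually come from positivity;
  as \<open>x\<close> is skew-adjoint, \<open>z\<close> factors as \<open>(1 + x) * (1 - x)\<close>, and both factors are invertible. The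
  element \<open>z\<close> commutes with \<open>e\<close> and \<open>star e\<close> because \<open>e * z = e * star e * e = z * e\<close>. Since the
  projection is a multiple of \<open>e\<close>, it lies in every ideal that contains \<open>e\<close>.
\<close>
lemma proj_in_fixed_moduleI:
  fixes e :: "'a::unital_cstar_algebra"
  assumes "selfadjoint_ideal \<F>" "e * e = e" "e \<in> \<F>"
  shows "proj_in \<F> (fixed_module e)"
proof -
  define s where "s = star e"
  define x where "x = s - e"
  define z where "z = (1 + x) * (1 + (- x))"
  have star_s: "star s = e" "star e = s" by (simp_all add: s_def star_star)
  have ss: "s * s = s" using assms(2) by (metis s_def star_mult)
  have "star x = - x" "star (- x) = - (- x)"
    by (simp_all add: x_def star_diff star_minus star_s)
  then obtain y1 y2 where y: "(1 + x) * y1 = 1" "y1 * (1 + x) = 1"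
      "(1 + (- x)) * y2 = 1" "y2 * (1 + (- x)) = 1"
    by (metis skew_adjoint_one_plus_invertible)
  define w where "w = y2 * y1"
  have zw: "z * w = 1" unfolding z_def w_def using y by (metis mult.assoc mult_1_right)
  have wz: "w * z = 1" unfolding z_def w_def using y by (metis mult.assoc mult_1_right)
  have z: "z = 1 + e * s + s * e - e - s"
    using ss assms(2) by (simp add: z_def x_def algebra_simps)
  have ez: "e * z = e * s * e"
    unfolding z using assms(2) by (simp add: algebra_simps flip: mult.assoc)
  have ze: "z * e = e * s * e"
    unfolding z using assms(2) by (simp add: algebra_simps)
  have sz: "s * z = s * e * s"
    unfolding z using ss by (simp add: algebra_simps flip: mult.assoc)
  have zs: "z * s = s * e * s"
    unfolding z using ss by (simp add: algebra_simps)
  have we: "w * e = e * w" by (metis ez mult.assoc mult_1_left mult_1_right wz ze zw)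
  have ws: "w * s = s * w" by (metis sz mult.assoc mult_1_left mult_1_right wz zs zw)
  have star_z: "star z = z"
    by (simp add: z star_diff star_add star_mult star_s algebra_simps)
  have star_w: "star w = w"
    by (metis star_z mult.assoc mult_1_left mult_1_right star_mult star_one wz zw)
  define p where "p = e * s * w"
  have "star p = w * e * s" by (simp add: p_def star_mult star_s star_w mult.assoc)
  then have star_p: "star p = p" by (simp add: p_def we ws mult.assoc)
  have pe: "p * e = e"
    by (metis p_def ez mult.assoc mult_1_right we zw)
  have ep: "e * p = p" by (simp add: p_def assms(2) flip: mult.assoc)
  have sp: "s * p = s" using arg_cong[OF pe, of star] by (simp add: star_mult star_p star_s)
  have "star y * (x - p * x) = 0" if "e * y = y" for x y
  proof -
    have "star y = star y * s" by (metis that star_mult star_s(2))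
    moreover have "s * (x - p * x) = 0"
      using sp by (simp add: right_diff_distrib flip: mult.assoc)
    ultimately show ?thesis by (metis mult.assoc mult_zero_right)
  qed
  moreover have "e * (p * x) = p * x" for x by (simp add: ep flip: mult.assoc)
  ultimately have "is_orthogonal_projection_onto ((*) p) (fixed_module e)"
    by (simp add: is_orthogonal_projection_onto_def ainner_def)
  moreover have "p \<in> \<F>"
    using assms(1,3) unfolding p_def selfadjoint_ideal_def by simp
  ultimately show ?thesis by (auto simp: proj_in_def)
qed

section \<open>Embeddings between these submodules\<close>

text \<open>
  A module map on the range of \<open>g\<close> is left multiplication by its value at \<open>g\<close>. It is an isomorphism
  onto a closed submodule iff it is bounded below: completeness of the domain makes the image closed.
  The image need not be complemented, so it cannot be described by an idempotent.
\<close>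
lemma embeds_fixed_module_iff:
  fixes g h :: "'a::unital_cstar_algebra"
  assumes "g * g = g"
  shows "fixed_module g \<preceq> fixed_module h \<longleftrightarrow>
    (\<exists>x c. c > 0 \<and> (\<forall>y. g * y = y \<longrightarrow> h * (x * y) = x * y \<and> c * norm y \<le> norm (x * y)))"
    (is "?L \<longleftrightarrow> ?R")
proof
  assume ?L
  then obtain K f where K: "K \<subseteq> fixed_module h" and iso: "module_iso f (fixed_module g) K"
    by (auto simp: embeds_def)
  let ?i = "inv_into (fixed_module g) f"
  have bij: "bij_betw f (fixed_module g) K" and f: "bounded_module_map f (fixed_module g) K"
    using iso by (auto simp: module_iso_def)
  have "\<exists>C. \<forall>x\<in>K. norm (?i x) \<le> C * norm x"
    using iso by (simp add: module_iso_def bounded_module_map_def)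
  then obtain C where C: "\<And>x. x \<in> K \<Longrightarrow> norm (?i x) \<le> C * norm x" by blast
  have fy: "f y = f g * y" if "g * y = y" for y
    using f assms that unfolding bounded_module_map_def by (metis mem_fixed_module)
  have "h * (f g * y) = f g * y \<and> (1 / (\<bar>C\<bar> + 1)) * norm y \<le> norm (f g * y)"
    if y: "g * y = y" for y
  proof -
    have fK: "f y \<in> K" using bij y by (auto simp: bij_betw_def)
    have "norm y \<le> C * norm (f y)"
      using C[OF fK] bij y by (simp add: bij_betw_inv_into_left)
    also have "\<dots> \<le> (\<bar>C\<bar> + 1) * norm (f y)"
      by (intro mult_right_mono) auto
    finally have "(1 / (\<bar>C\<bar> + 1)) * norm y \<le> norm (f y)"
      by (simp add: divide_le_eq mult.commute)
    then show ?thesis using K fK fy[OF y] by auto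
  qed
  then show ?R by (intro exI[of _ "f g"] exI[of _ "1 / (\<bar>C\<bar> + 1)"]) auto
next
  assume ?R
  then obtain x c where c: "c > 0"
    and x: "\<And>y. g * y = y \<Longrightarrow> h * (x * y) = x * y" "\<And>y. g * y = y \<Longrightarrow> c * norm y \<le> norm (x * y)"
    by blast
  let ?M = "fixed_module g" and ?K = "(*) x ` fixed_module g"
  have M: "closed_submodule ?M" by (rule closed_submodule_fixed_module)
  have "complete ?K"
  proof (rule complete_isometric_image[OF c])
    show "subspace ?M"
      by (auto simp: subspace_def distrib_left)
    show "complete ?M"
      using M by (simp add: closed_submodule_def complete_eq_closed)
  qed (use x(2) bounded_linear_mult_right in auto)
  then have "closed ?K" by (simp add: complete_eq_closed)
  moreover have "0 \<in> ?K" by (rule image_eqI[of _ _ 0]) auto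
  moreover have "u + v \<in> ?K" if "u \<in> ?K" "v \<in> ?K" for u v
    using that by (auto simp: distrib_left intro!: image_eqI[of _ _ "_ + _"])
  moreover have "u * a \<in> ?K" if "u \<in> ?K" for u a
    using that by (auto simp: mult.assoc intro!: image_eqI[of _ _ "_ * a"]) (metis mult.assoc)
  ultimately have K: "closed_submodule ?K" by (simp add: closed_submodule_def)
  have inj: "inj_on ((*) x) ?M"
  proof (rule inj_onI)
    fix y z assume "y \<in> ?M" "z \<in> ?M" "x * y = x * z"
    then have "g * (y - z) = y - z" "x * (y - z) = 0" by (simp_all add: right_diff_distrib)
    then have "c * norm (y - z) \<le> 0" using x(2) by fastforce
    then show "y = z" using c by (simp add: mult_le_0_iff)
  qed
  let ?i = "inv_into ?M ((*) x)"
  have i: "?i (x * y) = y" if "g * y = y" for y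
    using inj that by (simp add: inv_into_f_f)
  have "bounded_module_map ((*) x) ?M ?K"
    unfolding bounded_module_map_def
    by (auto simp: distrib_left mult.assoc intro!: exI[of _ "norm x"] norm_mult_ineq)
  moreover have "bounded_module_map ?i ?K ?M"
    unfolding bounded_module_map_def
  proof (intro conjI exI ballI allI)
    show "?i ` ?K \<subseteq> ?M" using i by auto
    show "?i (u + v) = ?i u + ?i v" if uv: "u \<in> ?K" "v \<in> ?K" for u v
    proof -
      obtain y z where "g * y = y" "g * z = z" "u = x * y" "v = x * z" using uv by auto
      then show ?thesis using i[of "y + z"] i[of y] i[of z] by (simp add: distrib_left)
    qed
    show "?i (u * a) = ?i u * a" if u: "u \<in> ?K" for u a
    proof -
      obtain y where y: "g * y = y" "u = x * y" using u by auto
      then have "g * (y * a) = y * a" by (metis mult.assoc)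
      then show ?thesis using i[of "y * a"] i[of y] y by (simp add: mult.assoc)
    qed
    show "norm (?i u) \<le> (1 / c) * norm u" if "u \<in> ?K" for u
      using that i x(2) c by (auto simp: le_divide_eq mult.commute)
  qed
  ultimately have "module_iso ((*) x) ?M ?K"
    using inj by (simp add: module_iso_def bij_betw_def)
  moreover have "?K \<subseteq> fixed_module h" using x(1) by auto
  ultimately show ?L using K unfolding embeds_def by blast
qed

lemma embeds_fixed_module_trans:
  assumes "g * g = g" "h * h = h"
    and "fixed_module g \<preceq> fixed_module h" "fixed_module h \<preceq> fixed_module k"
  shows "fixed_module g \<preceq> fixed_module k"
proof -
  obtain x c where x: "c > 0" "\<And>y. g * y = y \<Longrightarrow> h * (x * y) = x * y"
      "\<And>y. g * y = y \<Longrightarrow> c * norm y \<le> norm (x * y)"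
    using assms(1,3) by (auto simp: embeds_fixed_module_iff)
  obtain x' c' where x': "c' > 0" "\<And>y. h * y = y \<Longrightarrow> k * (x' * y) = x' * y"
      "\<And>y. h * y = y \<Longrightarrow> c' * norm y \<le> norm (x' * y)"
    using assms(2,4) by (auto simp: embeds_fixed_module_iff)
  have "c' * c * norm y \<le> norm (x' * x * y)" if "g * y = y" for y
  proof -
    have "c' * (c * norm y) \<le> c' * norm (x * y)" using x(3)[OF that] x'(1) by simp
    also have "\<dots> \<le> norm (x' * (x * y))" using x'(3) x(2)[OF that] by simp
    finally show ?thesis by (simp add: mult.assoc)
  qed
  moreover have "k * (x' * x * y) = x' * x * y" if "g * y = y" for y
    using x'(2)[OF x(2)[OF that]] by (simp add: mult.assoc)
  ultimately show ?thesis
    using assms(1) x(1) x'(1)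
    by (auto simp: embeds_fixed_module_iff intro!: exI[of _ "x' * x"] exI[of _ "c' * c"])
qed

lemma embeds_fixed_moduleI:
  fixes g h x y :: "'a::unital_cstar_algebra"
  assumes "g * g = g" "h * x * g = x * g" "y * x * g = g"
  shows "fixed_module g \<preceq> fixed_module h"
proof -
  have "h * (x * w) = x * w \<and> (1 / (norm y + 1)) * norm w \<le> norm (x * w)" if w: "g * w = w" for w
  proof -
    have "y * (x * w) = w" by (metis assms(3) mult.assoc w)
    then have "norm w \<le> norm y * norm (x * w)" by (metis norm_mult_ineq)
    also have "\<dots> \<le> (norm y + 1) * norm (x * w)" by (intro mult_right_mono) auto
    finally have "norm w / (norm y + 1) \<le> norm (x * w)"
      by (simp add: divide_le_eq mult.commute add_nonneg_pos)
    moreover have "h * (x * w) = x * w" by (metis assms(2) mult.assoc w)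
    ultimately show ?thesis by simp
  qed
  moreover have "1 / (norm y + 1) > 0" by (simp add: add_nonneg_pos)
  ultimately show ?thesis unfolding embeds_fixed_module_iff[OF assms(1)] by blast
qed

text \<open>
  The two embeddings combine to one of the direct sum: the bounded maps \<open>h\<close> and \<open>k\<close> recover its two
  components, and each of these bounds the corresponding component of the argument.
\<close>
lemma embeds_fixed_module_sum:
  fixes g h r k :: "'a::unital_cstar_algebra"
  assumes g: "g * g = g" "r * r = r" "g * r = 0" "r * g = 0"
    and h: "h * h = h" "k * k = k" "h * k = 0" "k * h = 0"
    and gh: "fixed_module g \<preceq> fixed_module h" and rk: "fixed_module r \<preceq> fixed_module k"
  shows "fixed_module (g + r) \<preceq> fixed_module (h + k)"
proof -
  obtain x c where x: "c > 0" "\<And>y. g * y = y \<Longrightarrow> h * (x * y) = x * y"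
      "\<And>y. g * y = y \<Longrightarrow> c * norm y \<le> norm (x * y)"
    using g(1) gh by (auto simp: embeds_fixed_module_iff)
  obtain x' c' where x': "c' > 0" "\<And>y. r * y = y \<Longrightarrow> k * (x' * y) = x' * y"
      "\<And>y. r * y = y \<Longrightarrow> c' * norm y \<le> norm (x' * y)"
    using g(2) rk by (auto simp: embeds_fixed_module_iff)
  let ?T = "x * g + x' * r"
  define C where "C = norm h / c + norm k / c'"
  have C0: "C \<ge> 0" using x(1) x'(1) by (simp add: C_def)
  have "(h + k) * (?T * w) = ?T * w \<and> (1 / (C + 1)) * norm w \<le> norm (?T * w)"
    if w: "(g + r) * w = w" for w
  proof -
    have gw: "g * (g * w) = g * w" and rw: "r * (r * w) = r * w"
      using g by (simp_all flip: mult.assoc)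
    have Tw: "?T * w = x * (g * w) + x' * (r * w)" by (simp add: algebra_simps)
    have hx: "h * (x * (g * w)) = x * (g * w)" and kx: "k * (x' * (r * w)) = x' * (r * w)"
      using x(2)[OF gw] x'(2)[OF rw] by auto
    have "h * (x' * (r * w)) = 0" "k * (x * (g * w)) = 0"
      by (metis h(3) kx mult.assoc mult_zero_left, metis h(4) hx mult.assoc mult_zero_left)
    then have hT: "h * (?T * w) = x * (g * w)" and kT: "k * (?T * w) = x' * (r * w)"
      using hx kx by (simp_all add: Tw distrib_left)
    have "c * norm (g * w) \<le> norm h * norm (?T * w)"
      using x(3)[OF gw] norm_mult_ineq[of h "?T * w"] hT by simp
    then have 1: "norm (g * w) \<le> norm h / c * norm (?T * w)"
      using x(1) by (simp add: field_simps)
    have "c' * norm (r * w) \<le> norm k * norm (?T * w)"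
      using x'(3)[OF rw] norm_mult_ineq[of k "?T * w"] kT by simp
    then have 2: "norm (r * w) \<le> norm k / c' * norm (?T * w)"
      using x'(1) by (simp add: field_simps)
    have "norm w \<le> norm (g * w) + norm (r * w)"
      using norm_triangle_ineq[of "g * w" "r * w"] w by (simp add: distrib_right)
    also have "\<dots> \<le> C * norm (?T * w)" using 1 2 by (simp add: C_def distrib_right)
    also have "\<dots> \<le> (C + 1) * norm (?T * w)" by (intro mult_right_mono) auto
    finally have "norm w / (C + 1) \<le> norm (?T * w)"
      using C0 by (simp add: divide_le_eq mult.commute add_nonneg_pos)
    then show ?thesis using hT kT Tw by (simp add: distrib_right)
  qed
  moreover have "1 / (C + 1) > 0" using C0 by simp
  moreover have "(g + r) * (g + r) = g + r" using g by (simp add: algebra_simps)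
  ultimately show ?thesis unfolding embeds_fixed_module_iff[OF \<open>(g + r) * (g + r) = g + r\<close>] by blast
qed

text \<open>
  Since \<open>z'\<close> maps the range of \<open>g\<close> into the range of \<open>f\<close>, it induces a map from the quotient by the
  former to the quotient by the latter. The ranges of \<open>1 - g\<close> and \<open>1 - f\<close> are copies of these
  quotients, and \<open>z\<close> provides a right inverse of the induced map, which is the embedding.
\<close>
lemma embeds_complement:
  fixes f g z z' :: "'a::unital_cstar_algebra"
  assumes "f * f = f" "g * g = g" "z' * z = 1" "f * (z' * g) = z' * g"
  shows "fixed_module (1 - f) \<preceq> fixed_module (1 - g)"
proof (rule embeds_fixed_moduleI)
  show "(1 - f) * (1 - f) = 1 - f"
    using assms by (simp add: algebra_simps)
  have gg: "g * (g * y) = g * y" for y using assms(2) by (simp flip: mult.assoc)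
  show "(1 - g) * ((1 - g) * z) * (1 - f) = (1 - g) * z * (1 - f)"
    by (simp add: algebra_simps gg)
  have zg: "(1 - f) * (z' * g) = 0" using assms(4) by (simp add: left_diff_distrib)
  have "(1 - f) * z' * ((1 - g) * z) * (1 - f)
      = (1 - f) * (z' * z) * (1 - f) - (1 - f) * (z' * g) * (z * (1 - f))"
    by (simp add: algebra_simps)
  also have "\<dots> = 1 - f" using assms(1,3) zg by (simp add: algebra_simps)
  finally show "(1 - f) * z' * ((1 - g) * z) * (1 - f) = 1 - f" .
qed

section \<open>Decompositions and outer inverses\<close>

text \<open>The outer inverse is the inverse of \<open>F1\<close>, extended by zero on \<open>N2\<close>.\<close>
lemma iso_decomposition_outer_inverse:
  fixes a :: "'a::unital_cstar_algebra"
  assumes "iso_decomposition ((*) a) M1 N1 M2 N2"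
  obtains b where "b * a * b = b" "N1 = fixed_module (1 - b * a)" "N2 = fixed_module (1 - a * b)"
proof -
  obtain e where e: "e * e = e" "M1 = fixed_module e" "N1 = fixed_module (1 - e)"
    using assms by (auto simp: iso_decomposition_def elim: direct_decomposition_idempotent)
  obtain f where f: "f * f = f" "M2 = fixed_module f" "N2 = fixed_module (1 - f)"
    using assms by (auto simp: iso_decomposition_def elim: direct_decomposition_idempotent)
  let ?i = "inv_into M1 ((*) a)"
  have aM: "(*) a ` M1 \<subseteq> M2" and aN: "(*) a ` N1 \<subseteq> N2" and bij: "bij_betw ((*) a) M1 M2"
    and i: "bounded_module_map ?i M2 M1"
    using assms by (auto simp: iso_decomposition_def module_iso_def)
  define b where "b = ?i f"
  have fM: "f \<in> M2" and eM: "e \<in> M1" using e f by auto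
  have ib: "?i y = b * y" if "y \<in> M2" for y
    using i fM that f(2) unfolding bounded_module_map_def b_def by (metis mem_fixed_module)
  have ab: "a * b = f"
    using bij fM unfolding b_def bij_betw_def by (simp add: f_inv_into_f)
  have "b \<in> M1" using i fM unfolding bounded_module_map_def b_def by auto
  then have eb: "e * b = b" using e by simp
  have bf: "b * f = b" using ib[OF fM] by (simp add: b_def)
  have fae: "f * (a * e) = a * e" using aM eM f(2) by auto
  have "1 - e \<in> N1" using e by (simp add: algebra_simps)
  then have "(1 - f) * (a * (1 - e)) = a * (1 - e)" using aN f(3) by auto
  then have fa: "f * a = a * e" using fae by (simp add: algebra_simps)
  have "b * (a * e) = e"
    using ib[of "a * e"] aM eM bij by (auto simp: bij_betw_inv_into_left)
  then have "b * a = e" by (metis bf fa mult.assoc)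
  then show ?thesis using that[of b] e f eb ab by auto
qed

lemma outer_inverse_iso_decomposition:
  fixes a b :: "'a::unital_cstar_algebra"
  assumes "b * a * b = b"
  shows "iso_decomposition ((*) a) (fixed_module (b * a)) (fixed_module (1 - b * a))
    (fixed_module (a * b)) (fixed_module (1 - a * b))"
proof -
  have bab: "b * (a * b) = b" "b * (a * (b * y)) = b * y" for y
    using assms by (metis mult.assoc)+
  let ?M = "fixed_module (b * a)" and ?M2 = "fixed_module (a * b)"
  have inj: "inj_on ((*) a) ?M" by (rule inj_onI) (metis mem_fixed_module mult.assoc)
  have im: "(*) a ` ?M = ?M2"
  proof
    show "(*) a ` ?M \<subseteq> ?M2" by (auto simp: mult.assoc)
    show "?M2 \<subseteq> (*) a ` ?M"
    proof
      fix y assume "y \<in> ?M2"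
      then show "y \<in> (*) a ` ?M"
        by (intro image_eqI[of _ _ "b * y"]) (simp_all add: mult.assoc bab)
    qed
  qed
  let ?i = "inv_into ?M ((*) a)"
  have i: "?i y = b * y" if "y \<in> ?M2" for y
    using that by (intro inv_into_f_eq[OF inj]) (simp_all add: mult.assoc bab)
  have M2: "closed_submodule ?M2" by (rule closed_submodule_fixed_module)
  have "bounded_module_map ((*) a) ?M ?M2"
    unfolding bounded_module_map_def using im
    by (auto simp: distrib_left mult.assoc intro!: exI[of _ "norm a"] norm_mult_ineq)
  moreover have "bounded_module_map ?i ?M2 ?M"
    unfolding bounded_module_map_def
  proof (intro conjI exI ballI allI)
    show "?i ` ?M2 \<subseteq> ?M" using i by (auto simp: mult.assoc bab)
    show "?i (u + v) = ?i u + ?i v" if "u \<in> ?M2" "v \<in> ?M2" for u v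
      using M2 i that unfolding closed_submodule_def by (metis distrib_left)
    show "?i (u * y) = ?i u * y" if "u \<in> ?M2" for u y
      using M2 i that unfolding closed_submodule_def by (metis mult.assoc)
    show "norm (?i u) \<le> norm b * norm u" if "u \<in> ?M2" for u
      using i[OF that] by (simp add: norm_mult_ineq)
  qed
  ultimately have "module_iso ((*) a) ?M ?M2"
    using inj im by (simp add: module_iso_def bij_betw_def)
  moreover have "(*) a ` fixed_module (1 - b * a) \<subseteq> fixed_module (1 - a * b)"
    by (auto simp: algebra_simps)
  moreover have "b * a * (b * a) = b * a" "a * b * (a * b) = a * b"
    by (simp_all add: mult.assoc bab)
  ultimately show ?thesis
    using im by (simp add: iso_decomposition_def direct_decomposition_fixed_module)
qed

section \<open>Shrinking a decomposition\<close>

text \<open>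
  The conditions on \<open>b'\<close> say that its decomposition is obtained from that of \<open>b\<close> by moving the range of
  \<open>b * a - b' * a\<close> from \<open>M1\<close> to \<open>N1\<close> and its image under \<open>a\<close>, the range of \<open>a * b - a * b'\<close>, from \<open>M2\<close>
  to \<open>N2\<close>. So \<open>N1\<close> and \<open>N2\<close> each gain a direct summand, and these two summands are isomorphic by \<open>a\<close>
  and \<open>b\<close>.
\<close>
lemma outer_inverse_le_embeds:
  fixes a b b' :: "'a::unital_cstar_algebra"
  assumes b: "b * a * b = b" and b': "b' * a * b' = b'" "b' * a * b = b'" "b * a * b' = b'"
  shows "fixed_module (1 - b * a) \<preceq> fixed_module (1 - a * b) \<Longrightarrow>
      fixed_module (1 - b' * a) \<preceq> fixed_module (1 - a * b')"
    and "fixed_module (1 - a * b) \<preceq> fixed_module (1 - b * a) \<Longrightarrow>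
      fixed_module (1 - a * b') \<preceq> fixed_module (1 - b' * a)"
proof -
  have rules: "b * (a * b) = b" "b * (a * (b * y)) = b * y"
    "b' * (a * b') = b'" "b' * (a * (b' * y)) = b' * y"
    "b' * (a * b) = b'" "b' * (a * (b * y)) = b' * y"
    "b * (a * b') = b'" "b * (a * (b' * y)) = b' * y" for y
    using b b' by (metis mult.assoc)+
  let ?r = "b * a - b' * a" and ?k = "a * b - a * b'"
  have rk: "fixed_module ?r \<preceq> fixed_module ?k"
    by (rule embeds_fixed_moduleI[where x = a and y = b]) (simp_all add: algebra_simps rules)
  have kr: "fixed_module ?k \<preceq> fixed_module ?r"
    by (rule embeds_fixed_moduleI[where x = b and y = a]) (simp_all add: algebra_simps rules)
  have eq: "(1 - b * a) + ?r = 1 - b' * a" "(1 - a * b) + ?k = 1 - a * b'" by auto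
  {
    assume "fixed_module (1 - b * a) \<preceq> fixed_module (1 - a * b)"
    from embeds_fixed_module_sum[OF _ _ _ _ _ _ _ _ this rk]
    show "fixed_module (1 - b' * a) \<preceq> fixed_module (1 - a * b')"
      unfolding eq by (simp add: algebra_simps rules)
  next
    assume "fixed_module (1 - a * b) \<preceq> fixed_module (1 - b * a)"
    from embeds_fixed_module_sum[OF _ _ _ _ _ _ _ _ this kr]
    show "fixed_module (1 - a * b') \<preceq> fixed_module (1 - b' * a)"
      unfolding eq by (simp add: algebra_simps rules)
  }
qed

text \<open>
  If \<open>1 - b * a\<close> is almost fixed by \<open>p\<close>, then \<open>u\<close> is close to \<open>1\<close>. It maps the range of \<open>p\<close> identically
  and agrees with \<open>b * a\<close> on the range of \<open>1 - p\<close>; thus it moves the latter into \<open>M1\<close>. The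
  idempotent \<open>u * (1 - p) * v\<close> projects onto the moved copy, which becomes the first summand of the
  decomposition that belongs to \<open>b'\<close>. The last two equations show that its other two summands remain
  finite when \<open>p\<close> is.
\<close>
lemma shrink_outer_inverse:
  fixes a b p u v :: "'a::unital_cstar_algebra"
  defines "b' \<equiv> u * (1 - p) * v * b"
  assumes b: "b * a * b = b" and p: "p * p = p"
    and u: "u = 1 - (1 - b * a) * (1 - p)" and uv: "u * v = 1" "v * u = 1"
  shows "b' * a * b' = b'" "b' * a * b = b'" "b * a * b' = b'"
    and "b' * a * (u * (1 - p)) = u * (1 - p)"
    and "1 - b' * a = (1 - b * a) + u * p * v * b * a"
    and "1 - a * b' = (1 - a * b) + a * u * p * v * b"
proof -
  have bab: "b * (a * b) = b" "b * (a * (b * y)) = b * y" for y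
    using b by (metis mult.assoc)+
  have "u * (1 - p) = b * a * (1 - p)"
    using p by (simp add: u algebra_simps)
  then have bau: "b * a * (u * (1 - p)) = u * (1 - p)"
    by (simp add: mult.assoc bab)
  have pp: "(1 - p) * (1 - p) = 1 - p" using p by (simp add: algebra_simps)
  have "b' * a * (u * (1 - p)) = u * (1 - p) * v * (b * a * (u * (1 - p)))"
    by (simp only: b'_def mult.assoc)
  also have "\<dots> = u * ((1 - p) * (v * u) * (1 - p))"
    unfolding bau by (simp only: mult.assoc)
  also have "\<dots> = u * (1 - p)" by (simp only: uv mult_1_right pp)
  finally show b'au: "b' * a * (u * (1 - p)) = u * (1 - p)" .
  have b': "b' = u * (1 - p) * (v * b)" by (simp only: b'_def mult.assoc)
  show "b' * a * b' = b'"
    using b'au by (metis b' mult.assoc)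
  show "b' * a * b = b'"
    using bab(1) by (metis b'_def mult.assoc)
  show "b * a * b' = b'"
    using bau by (metis b' mult.assoc)
  have "u * p * v = 1 - u * (1 - p) * v"
    using uv by (simp add: algebra_simps)
  then have "u * p * v * b = b - b'"
    by (simp add: b'_def left_diff_distrib)
  then show "1 - b' * a = (1 - b * a) + u * p * v * b * a"
      "1 - a * b' = (1 - a * b) + a * u * p * v * b"
    by (simp_all add: left_diff_distrib right_diff_distrib mult.assoc)
qed

text \<open>
  The first summands of both shrunk decompositions are moved copies of the range of \<open>1 - p\<close>, under
  \<open>u\<^sub>1\<close> and under \<open>u\<^sub>2\<close>. Therefore \<open>u\<^sub>1 * v\<^sub>2\<close> carries the second one onto the first.
\<close>
lemma shrunk_kernels_embed:
  fixes a b\<^sub>1 b\<^sub>2 p u\<^sub>1 v\<^sub>1 u\<^sub>2 v\<^sub>2 :: "'a::unital_cstar_algebra"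
  assumes p: "p * p = p"
    and 1: "b\<^sub>1 * a * b\<^sub>1 = b\<^sub>1" "u\<^sub>1 = 1 - (1 - b\<^sub>1 * a) * (1 - p)" "u\<^sub>1 * v\<^sub>1 = 1" "v\<^sub>1 * u\<^sub>1 = 1"
    and 2: "b\<^sub>2 * a * b\<^sub>2 = b\<^sub>2" "u\<^sub>2 = 1 - (1 - b\<^sub>2 * a) * (1 - p)" "u\<^sub>2 * v\<^sub>2 = 1" "v\<^sub>2 * u\<^sub>2 = 1"
  shows "fixed_module (1 - u\<^sub>2 * (1 - p) * v\<^sub>2 * b\<^sub>2 * a) \<preceq> fixed_module (1 - u\<^sub>1 * (1 - p) * v\<^sub>1 * b\<^sub>1 * a)"
proof -
  note s1 = shrink_outer_inverse[OF 1(1) p 1(2-)] and s2 = shrink_outer_inverse[OF 2(1) p 2(2-)]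
  show ?thesis
  proof (rule embeds_complement[where z = "u\<^sub>1 * v\<^sub>2" and z' = "u\<^sub>2 * v\<^sub>1"])
    show "u\<^sub>2 * (1 - p) * v\<^sub>2 * b\<^sub>2 * a * (u\<^sub>2 * (1 - p) * v\<^sub>2 * b\<^sub>2 * a) = u\<^sub>2 * (1 - p) * v\<^sub>2 * b\<^sub>2 * a"
      using s2(1) by (metis mult.assoc)
    show "u\<^sub>1 * (1 - p) * v\<^sub>1 * b\<^sub>1 * a * (u\<^sub>1 * (1 - p) * v\<^sub>1 * b\<^sub>1 * a) = u\<^sub>1 * (1 - p) * v\<^sub>1 * b\<^sub>1 * a"
      using s1(1) by (metis mult.assoc)
    show "u\<^sub>2 * v\<^sub>1 * (u\<^sub>1 * v\<^sub>2) = 1"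
      using 1(4) 2(3) by (metis mult.assoc mult_1_left)
    have "u\<^sub>2 * v\<^sub>1 * (u\<^sub>1 * (1 - p) * v\<^sub>1 * b\<^sub>1 * a) = u\<^sub>2 * (v\<^sub>1 * u\<^sub>1) * ((1 - p) * v\<^sub>1 * b\<^sub>1 * a)"
      by (simp only: mult.assoc)
    also have "\<dots> = u\<^sub>2 * (1 - p) * (v\<^sub>1 * b\<^sub>1 * a)"
      by (simp only: 1(4) mult_1_right mult.assoc)
    finally have eq: "u\<^sub>2 * v\<^sub>1 * (u\<^sub>1 * (1 - p) * v\<^sub>1 * b\<^sub>1 * a) = u\<^sub>2 * (1 - p) * (v\<^sub>1 * b\<^sub>1 * a)" .
    show "u\<^sub>2 * (1 - p) * v\<^sub>2 * b\<^sub>2 * a * (u\<^sub>2 * v\<^sub>1 * (u\<^sub>1 * (1 - p) * v\<^sub>1 * b\<^sub>1 * a))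
        = u\<^sub>2 * v\<^sub>1 * (u\<^sub>1 * (1 - p) * v\<^sub>1 * b\<^sub>1 * a)"
      unfolding eq using s2(4) by (metis mult.assoc)
  qed
qed

text \<open>
  The images of the first summands under \<open>a\<close> are the ranges of \<open>w\<^sub>1\<close> and \<open>w\<^sub>2\<close>, two nearby maps
  defined on the range of \<open>1 - p\<close>. With a left inverse \<open>l\<close> of \<open>w\<^sub>1\<close>, the element
  \<open>1 + (w\<^sub>2 - w\<^sub>1) * l\<close> is a perturbation of \<open>1\<close> that carries \<open>w\<^sub>1\<close> to \<open>w\<^sub>2\<close>. The hypothesis \<open>small\<close>
  makes it invertible.
\<close>
lemma shrunk_cokernels_embed:
  fixes a b\<^sub>1 b\<^sub>2 p u\<^sub>1 v\<^sub>1 u\<^sub>2 v\<^sub>2 :: "'a::unital_cstar_algebra"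
  assumes p: "p * p = p"
    and 1: "b\<^sub>1 * a * b\<^sub>1 = b\<^sub>1" "u\<^sub>1 = 1 - (1 - b\<^sub>1 * a) * (1 - p)" "u\<^sub>1 * v\<^sub>1 = 1" "v\<^sub>1 * u\<^sub>1 = 1"
    and 2: "b\<^sub>2 * a * b\<^sub>2 = b\<^sub>2" "u\<^sub>2 = 1 - (1 - b\<^sub>2 * a) * (1 - p)" "u\<^sub>2 * v\<^sub>2 = 1" "v\<^sub>2 * u\<^sub>2 = 1"
    and small: "norm (a * (u\<^sub>2 - u\<^sub>1) * v\<^sub>1 * b\<^sub>1) < 1"
  shows "fixed_module (1 - a * (u\<^sub>1 * (1 - p) * v\<^sub>1 * b\<^sub>1)) \<preceq> fixed_module (1 - a * (u\<^sub>2 * (1 - p) * v\<^sub>2 * b\<^sub>2))"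
proof -
  note s1 = shrink_outer_inverse[OF 1(1) p 1(2-)] and s2 = shrink_outer_inverse[OF 2(1) p 2(2-)]
  define w\<^sub>1 where "w\<^sub>1 = a * u\<^sub>1 * (1 - p)"
  define w\<^sub>2 where "w\<^sub>2 = a * u\<^sub>2 * (1 - p)"
  define l where "l = (1 - p) * v\<^sub>1 * b\<^sub>1"
  define z where "z = 1 + (w\<^sub>2 - w\<^sub>1) * l"
  have pp: "(1 - p) * (1 - p) = 1 - p" using p by (simp add: algebra_simps)
  have "u\<^sub>1 * l * w\<^sub>1 = u\<^sub>1 * (1 - p)"
    using s1(4) by (simp only: l_def w\<^sub>1_def mult.assoc)
  then have lw: "l * w\<^sub>1 = 1 - p"
    using 1(4) by (metis mult.assoc mult_1_left)
  have w1p: "w\<^sub>1 * (1 - p) = w\<^sub>1" and w2p: "w\<^sub>2 * (1 - p) = w\<^sub>2"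
    by (simp_all only: w\<^sub>1_def w\<^sub>2_def mult.assoc pp)
  have "(w\<^sub>2 - w\<^sub>1) * (l * w\<^sub>1) = w\<^sub>2 - w\<^sub>1"
    unfolding lw left_diff_distrib w1p w2p ..
  then have zw: "z * w\<^sub>1 = w\<^sub>2"
    by (simp add: z_def distrib_right mult.assoc)
  have "w\<^sub>2 - w\<^sub>1 = a * (u\<^sub>2 - u\<^sub>1)"
    using p by (simp add: w\<^sub>1_def w\<^sub>2_def 1(2) 2(2) algebra_simps)
  moreover have "(w\<^sub>2 - w\<^sub>1) * l = (w\<^sub>2 - w\<^sub>1) * (1 - p) * (v\<^sub>1 * b\<^sub>1)"
    by (simp only: l_def mult.assoc)
  moreover have "(w\<^sub>2 - w\<^sub>1) * (1 - p) = w\<^sub>2 - w\<^sub>1"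
    unfolding left_diff_distrib w1p w2p ..
  ultimately have "(w\<^sub>2 - w\<^sub>1) * l = a * (u\<^sub>2 - u\<^sub>1) * v\<^sub>1 * b\<^sub>1"
    by (metis mult.assoc)
  then have "1 - z = - (a * (u\<^sub>2 - u\<^sub>1) * v\<^sub>1 * b\<^sub>1)"
    by (simp add: z_def)
  then have "norm (1 - z) < 1" using small by simp
  then obtain z' where z': "z' * z = 1" by (rule neumann_inverse)
  have z'w: "z' * w\<^sub>2 = w\<^sub>1" using zw z' by (metis mult.assoc mult_1_left)
  show ?thesis
  proof (rule embeds_complement[OF _ _ z'])
    show "a * (u\<^sub>1 * (1 - p) * v\<^sub>1 * b\<^sub>1) * (a * (u\<^sub>1 * (1 - p) * v\<^sub>1 * b\<^sub>1)) = a * (u\<^sub>1 * (1 - p) * v\<^sub>1 * b\<^sub>1)"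
      using s1(1) by (metis mult.assoc)
    show "a * (u\<^sub>2 * (1 - p) * v\<^sub>2 * b\<^sub>2) * (a * (u\<^sub>2 * (1 - p) * v\<^sub>2 * b\<^sub>2)) = a * (u\<^sub>2 * (1 - p) * v\<^sub>2 * b\<^sub>2)"
      using s2(1) by (metis mult.assoc)
    have "z' * (a * (u\<^sub>2 * (1 - p) * v\<^sub>2 * b\<^sub>2)) = z' * w\<^sub>2 * (v\<^sub>2 * b\<^sub>2)"
      by (simp only: w\<^sub>2_def mult.assoc)
    then have eq: "z' * (a * (u\<^sub>2 * (1 - p) * v\<^sub>2 * b\<^sub>2)) = w\<^sub>1 * (v\<^sub>2 * b\<^sub>2)"
      unfolding z'w .
    have "a * (u\<^sub>1 * (1 - p) * v\<^sub>1 * b\<^sub>1) * w\<^sub>1 = w\<^sub>1"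
      using s1(4) by (simp only: w\<^sub>1_def mult.assoc)
    then show "a * (u\<^sub>1 * (1 - p) * v\<^sub>1 * b\<^sub>1) * (z' * (a * (u\<^sub>2 * (1 - p) * v\<^sub>2 * b\<^sub>2)))
        = z' * (a * (u\<^sub>2 * (1 - p) * v\<^sub>2 * b\<^sub>2))"
      unfolding eq by (metis mult.assoc)
  qed
qed

section \<open>Finite type ideals\<close>

lemma selfadjoint_ideal_closed:
  assumes "selfadjoint_ideal \<F>"
  shows "x \<in> \<F> \<Longrightarrow> y \<in> \<F> \<Longrightarrow> x + y \<in> \<F>" "x \<in> \<F> \<Longrightarrow> y \<in> \<F> \<Longrightarrow> x - y \<in> \<F>"
    "x \<in> \<F> \<Longrightarrow> c * x \<in> \<F>" "x \<in> \<F> \<Longrightarrow> x * c \<in> \<F>"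
proof -
  show add: "x \<in> \<F> \<Longrightarrow> y \<in> \<F> \<Longrightarrow> x + y \<in> \<F>" for x y
    using assms by (simp add: selfadjoint_ideal_def subalgebra_def)
  show mult: "x \<in> \<F> \<Longrightarrow> c * x \<in> \<F>" "x \<in> \<F> \<Longrightarrow> x * c \<in> \<F>" for x c
    using assms by (simp_all add: selfadjoint_ideal_def)
  show "x \<in> \<F> \<Longrightarrow> y \<in> \<F> \<Longrightarrow> x - y \<in> \<F>"
    using add[of x "(- 1) * y"] mult(1)[of y "- 1"] by simp
qed

text \<open>A left inverse and a right inverse of the class of \<open>a\<close> coincide in the quotient by the ideal.\<close>
lemma inverse_modulo_ideal:
  assumes I: "selfadjoint_ideal \<F>" and "1 - c * a \<in> \<F>" "1 - a * d \<in> \<F>"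
  shows "1 - a * c \<in> \<F>" "1 - d * a \<in> \<F>"
proof -
  have "c - d = c * (1 - a * d) - (1 - c * a) * d" by (simp add: algebra_simps)
  then have cd: "c - d \<in> \<F>"
    using assms(2,3) by (simp only: selfadjoint_ideal_closed[OF I])
  have "1 - a * c = (1 - a * d) - a * (c - d)" "1 - d * a = (1 - c * a) + (c - d) * a"
    by (simp_all add: algebra_simps)
  then show "1 - a * c \<in> \<F>" "1 - d * a \<in> \<F>"
    using assms(2,3) cd by (simp_all only: selfadjoint_ideal_closed[OF I])
qed

lemma approximating_projection:
  assumes "has_approximate_unit_of_projections \<F>" "x \<in> \<F>" "y \<in> \<F>" "\<delta> > 0"
  obtains p where "p \<in> \<F>" "p * p = p" "norm (x * (1 - p)) < \<delta>" "norm (y * (1 - p)) < \<delta>"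
proof -
  obtain U where U: "U \<noteq> bot" "\<forall>\<^sub>F p in U. p \<in> \<F> \<and> is_projection p"
    "((\<lambda>p. x * p) \<longlongrightarrow> x) U" "((\<lambda>p. y * p) \<longlongrightarrow> y) U"
    using assms(1-3) by (auto simp: has_approximate_unit_of_projections_def)
  from U(2) tendstoD[OF U(3) assms(4)] tendstoD[OF U(4) assms(4)]
  have "\<forall>\<^sub>F p in U. p \<in> \<F> \<and> p * p = p \<and> norm (x * (1 - p)) < \<delta> \<and> norm (y * (1 - p)) < \<delta>"
    by eventually_elim
      (simp add: is_projection_def dist_norm right_diff_distrib norm_minus_commute)
  then show ?thesis using U(1) that by (blast dest: eventually_happens')
qed

lemma MKPhi_decomposition_outer_inverse:
  fixes a b :: "'a::unital_cstar_algebra"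
  assumes "selfadjoint_ideal \<F>" "b * a * b = b" "1 - b * a \<in> \<F>" "1 - a * b \<in> \<F>"
  shows "MKPhi_decomposition \<F> ((*) a) (fixed_module (b * a)) (fixed_module (1 - b * a))
    (fixed_module (a * b)) (fixed_module (1 - a * b))"
proof -
  have bab: "b * (a * b) = b" "b * (a * (b * y)) = b * y" for y
    using assms(2) by (metis mult.assoc)+
  have "(1 - b * a) * (1 - b * a) = 1 - b * a" "(1 - a * b) * (1 - a * b) = 1 - a * b"
    by (simp_all add: algebra_simps bab)
  then show ?thesis
    using assms proj_in_fixed_moduleI[OF assms(1)] outer_inverse_iso_decomposition[OF assms(2)]
    by (simp add: MKPhi_decomposition_def)
qed

lemma outer_inverse_proj_in:
  fixes a b :: "'a::unital_cstar_algebra"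
  assumes "selfadjoint_ideal \<F>" "b * a * b = b"
  shows "proj_in \<F> (fixed_module (1 - b * a)) \<Longrightarrow> 1 - b * a \<in> \<F>"
    and "proj_in \<F> (fixed_module (1 - a * b)) \<Longrightarrow> 1 - a * b \<in> \<F>"
proof -
  have bab: "b * (a * b) = b" "b * (a * (b * y)) = b * y" for y
    using assms(2) by (metis mult.assoc)+
  have "(1 - b * a) * (1 - b * a) = 1 - b * a" "(1 - a * b) * (1 - a * b) = 1 - a * b"
    by (simp_all add: algebra_simps bab)
  then show "proj_in \<F> (fixed_module (1 - b * a)) \<Longrightarrow> 1 - b * a \<in> \<F>"
    and "proj_in \<F> (fixed_module (1 - a * b)) \<Longrightarrow> 1 - a * b \<in> \<F>"
    using proj_in_fixed_moduleD[OF assms(1)] by blast+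
qed

theorem lemma3p11:
  fixes \<F> :: "'a::unital_cstar_algebra set" and F :: "'a \<Rightarrow> 'a"
  assumes "finite_type_ideal \<F>"
    and "F \<in> MKPhi \<F> \<inter> MKPhi_plus_minus' \<F> \<inter> MKPhi_minus_plus' \<F>"
  shows "\<exists>M1 N1 M2 N2. MKPhi_decomposition \<F> F M1 N1 M2 N2 \<and> N1 \<preceq> N2 \<and> N2 \<preceq> N1"
proof -
  have I: "selfadjoint_ideal \<F>" and unit: "has_approximate_unit_of_projections \<F>"
    using assms(1) by (auto simp: finite_type_ideal_def)
  note ideal = selfadjoint_ideal_closed[OF I]
  define a where "a = F 1"
  have "F \<in> module_operators" using assms(2) by (simp add: MKPhi_def)
  then have "F (1 * x) = F 1 * x" for x
    unfolding module_operators_def bounded_module_map_def by blast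
  then have F: "F = (*) a" unfolding a_def by (metis mult_1_left ext)
  \<comment> \<open>The three memberships of \<open>F\<close> give one outer inverse of \<open>a\<close> each.\<close>
  obtain b\<^sub>0 where b0: "1 - b\<^sub>0 * a \<in> \<F>" "1 - a * b\<^sub>0 \<in> \<F>"
  proof -
    obtain M1 N1 M2 N2 where D: "iso_decomposition ((*) a) M1 N1 M2 N2" "proj_in \<F> N1" "proj_in \<F> N2"
      using assms(2) by (auto simp: MKPhi_def MKPhi_decomposition_def F)
    from D(1) obtain b where "b * a * b = b" "N1 = fixed_module (1 - b * a)" "N2 = fixed_module (1 - a * b)"
      by (rule iso_decomposition_outer_inverse)
    then show ?thesis using D(2,3) outer_inverse_proj_in[OF I] that by blast
  qed
  obtain b\<^sub>1 where b1: "b\<^sub>1 * a * b\<^sub>1 = b\<^sub>1" "1 - b\<^sub>1 * a \<in> \<F>"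
    "fixed_module (1 - b\<^sub>1 * a) \<preceq> fixed_module (1 - a * b\<^sub>1)"
  proof -
    obtain M1 N1 M2 N2 where D: "iso_decomposition ((*) a) M1 N1 M2 N2" "proj_in \<F> N1" "N1 \<preceq> N2"
      using assms(2) by (auto simp: MKPhi_plus_minus'_def MKPhi_plus_decomposition_def F)
    from D(1) obtain b where "b * a * b = b" "N1 = fixed_module (1 - b * a)" "N2 = fixed_module (1 - a * b)"
      by (rule iso_decomposition_outer_inverse)
    then show ?thesis using D(2,3) outer_inverse_proj_in[OF I] that by blast
  qed
  obtain b\<^sub>2 where b2: "b\<^sub>2 * a * b\<^sub>2 = b\<^sub>2" "1 - a * b\<^sub>2 \<in> \<F>"
    "fixed_module (1 - a * b\<^sub>2) \<preceq> fixed_module (1 - b\<^sub>2 * a)"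
  proof -
    obtain M1 N1 M2 N2 where D: "iso_decomposition ((*) a) M1 N1 M2 N2" "proj_in \<F> N2" "N2 \<preceq> N1"
      using assms(2) by (auto simp: MKPhi_minus_plus'_def MKPhi_minus_decomposition_def F)
    from D(1) obtain b where "b * a * b = b" "N1 = fixed_module (1 - b * a)" "N2 = fixed_module (1 - a * b)"
      by (rule iso_decomposition_outer_inverse)
    then show ?thesis using D(2,3) outer_inverse_proj_in[OF I] that by blast
  qed
  have ab1: "1 - a * b\<^sub>1 \<in> \<F>" by (rule inverse_modulo_ideal(1)[OF I b1(2) b0(2)])
  have b2a: "1 - b\<^sub>2 * a \<in> \<F>" by (rule inverse_modulo_ideal(2)[OF I b0(1) b2(2)])

  \<comment> \<open>The element that \<open>shrunk_cokernels_embed\<close> needs to be small has norm at most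
    \<open>norm a * (2 * \<delta>) * 2 * norm b\<^sub>1\<close>, where the second \<open>2\<close> bounds the inverse of \<open>u\<^sub>1\<close> as soon as
    \<open>\<delta> \<le> 1 / 2\<close>. The choice of \<open>\<delta>\<close> ensures both conditions.\<close>
  define \<delta> where "\<delta> = 1 / (2 + 4 * (norm a * norm b\<^sub>1))"
  have ab0: "norm a * norm b\<^sub>1 \<ge> 0" by simp
  have \<delta>: "\<delta> > 0" "\<delta> \<le> 1 / 2" "4 * (norm a * norm b\<^sub>1) * \<delta> < 1"
    using ab0 by (simp_all add: \<delta>_def field_simps add_pos_nonneg)
  obtain p where p: "p \<in> \<F>" "p * p = p"
    and p1: "norm ((1 - b\<^sub>1 * a) * (1 - p)) < \<delta>" and p2: "norm ((1 - b\<^sub>2 * a) * (1 - p)) < \<delta>"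
    using approximating_projection[OF unit b1(2) b2a \<delta>(1)] by blast
  define u\<^sub>1 where "u\<^sub>1 = 1 - (1 - b\<^sub>1 * a) * (1 - p)"
  define u\<^sub>2 where "u\<^sub>2 = 1 - (1 - b\<^sub>2 * a) * (1 - p)"
  have n1: "norm (1 - u\<^sub>1) < \<delta>" and n2: "norm (1 - u\<^sub>2) < \<delta>"
    using p1 p2 by (simp_all add: u\<^sub>1_def u\<^sub>2_def)
  obtain v\<^sub>1 where v1: "u\<^sub>1 * v\<^sub>1 = 1" "v\<^sub>1 * u\<^sub>1 = 1" and nv: "norm v\<^sub>1 * (1 - norm (1 - u\<^sub>1)) \<le> 1"
    by (rule neumann_inverse[of u\<^sub>1]) (use n1 \<delta> in auto)
  obtain v\<^sub>2 where v2: "u\<^sub>2 * v\<^sub>2 = 1" "v\<^sub>2 * u\<^sub>2 = 1"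
    by (rule neumann_inverse[of u\<^sub>2]) (use n2 \<delta> in auto)
  define c\<^sub>1 where "c\<^sub>1 = u\<^sub>1 * (1 - p) * v\<^sub>1 * b\<^sub>1"
  define c\<^sub>2 where "c\<^sub>2 = u\<^sub>2 * (1 - p) * v\<^sub>2 * b\<^sub>2"
  note s1 = shrink_outer_inverse[OF b1(1) p(2) u\<^sub>1_def v1, folded c\<^sub>1_def]
  note s2 = shrink_outer_inverse[OF b2(1) p(2) u\<^sub>2_def v2, folded c\<^sub>2_def]

  have "norm v\<^sub>1 * (1 / 2) \<le> norm v\<^sub>1 * (1 - norm (1 - u\<^sub>1))"
    using n1 \<delta>(2) by (intro mult_left_mono) auto
  then have nv2: "norm v\<^sub>1 \<le> 2" using nv by simp
  have "norm (u\<^sub>2 - u\<^sub>1) \<le> 2 * \<delta>"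
    using norm_triangle_ineq4[of "1 - u\<^sub>1" "1 - u\<^sub>2"] n1 n2 by simp
  then have "norm a * norm (u\<^sub>2 - u\<^sub>1) * norm v\<^sub>1 * norm b\<^sub>1 \<le> norm a * (2 * \<delta>) * 2 * norm b\<^sub>1"
    using nv2 \<delta>(1) by (intro mult_mono) auto
  also have "\<dots> < 1" using \<delta>(3) by (simp add: mult_ac)
  finally have "norm a * norm (u\<^sub>2 - u\<^sub>1) * norm v\<^sub>1 * norm b\<^sub>1 < 1" .
  moreover have "norm (a * (u\<^sub>2 - u\<^sub>1) * v\<^sub>1 * b\<^sub>1) \<le> norm a * norm (u\<^sub>2 - u\<^sub>1) * norm v\<^sub>1 * norm b\<^sub>1"
    by (meson mult_right_mono norm_ge_zero norm_mult_ineq order_trans)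
  ultimately have small: "norm (a * (u\<^sub>2 - u\<^sub>1) * v\<^sub>1 * b\<^sub>1) < 1" by linarith

  have ker: "fixed_module (1 - c\<^sub>2 * a) \<preceq> fixed_module (1 - c\<^sub>1 * a)"
    unfolding c\<^sub>1_def c\<^sub>2_def
    by (rule shrunk_kernels_embed[OF p(2) b1(1) u\<^sub>1_def v1 b2(1) u\<^sub>2_def v2])
  have coker: "fixed_module (1 - a * c\<^sub>1) \<preceq> fixed_module (1 - a * c\<^sub>2)"
    unfolding c\<^sub>1_def c\<^sub>2_def
    by (rule shrunk_cokernels_embed[OF p(2) b1(1) u\<^sub>1_def v1 b2(1) u\<^sub>2_def v2 small])
  have N12: "fixed_module (1 - c\<^sub>1 * a) \<preceq> fixed_module (1 - a * c\<^sub>1)"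
    by (rule outer_inverse_le_embeds(1)[OF b1(1) s1(1-3) b1(3)])
  have "fixed_module (1 - a * c\<^sub>2) \<preceq> fixed_module (1 - c\<^sub>2 * a)"
    by (rule outer_inverse_le_embeds(2)[OF b2(1) s2(1-3) b2(3)])
  moreover have "(1 - a * c\<^sub>1) * (1 - a * c\<^sub>1) = 1 - a * c\<^sub>1" "(1 - a * c\<^sub>2) * (1 - a * c\<^sub>2) = 1 - a * c\<^sub>2"
    "(1 - c\<^sub>2 * a) * (1 - c\<^sub>2 * a) = 1 - c\<^sub>2 * a"
    using s1(1) s2(1) by (simp_all add: algebra_simps) (metis mult.assoc)+
  ultimately have N21: "fixed_module (1 - a * c\<^sub>1) \<preceq> fixed_module (1 - c\<^sub>1 * a)"
    using ker coker by (metis embeds_fixed_module_trans)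
  have "1 - c\<^sub>1 * a \<in> \<F>" "1 - a * c\<^sub>1 \<in> \<F>"
    unfolding s1(5,6) by (intro ideal b1(2) ab1 p(1))+
  then have "MKPhi_decomposition \<F> F (fixed_module (c\<^sub>1 * a)) (fixed_module (1 - c\<^sub>1 * a))
      (fixed_module (a * c\<^sub>1)) (fixed_module (1 - a * c\<^sub>1))"
    unfolding F by (rule MKPhi_decomposition_outer_inverse[OF I s1(1)])
  with N12 N21 show ?thesis by blast
qed

end
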